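(* Let $F$ be a field of characteristic $0$ and let $n$ be an even positive integer. Let $s_n=n\times\langle1\rangle$ be the sum-of-squares form $x_1^2+\dots+x_n^2$ on $F^n$. Then $$\omega(\mathcal G_{s_n,1})=\begin{cases}n,&\text{if }n+1\text{ is not a square in }F,\\ n+1,&\text{otherwise.}\end{cases}$$
   Context: For a quadratic form $q$ on an $F$-vector space $V$ and $a\in F$, $\mathcal G_{q,a}$ is the graph with vertex set $V$ and edge set $\{\{x,y\}\mid x\ne y,\ q(x-y)=a\}$; $\omega$ denotes the clique number (size of a largest clique). *)

theory Defs
  imports "HOL-Analysis.Finite_Cartesian_Product" "HOL-Library.Extended_Nat"
begin

text \<open>Simple graphs are pairs of a vertex set and a set of two-element edges;
  they may be infinite.\<close>

type_synonym 'v graph = "'v set \<times> 'v set set"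

definition clique :: "'v graph \<Rightarrow> 'v set \<Rightarrow> bool" where
  "clique G C \<longleftrightarrow> C \<subseteq> fst G \<and> (\<forall>x\<in>C. \<forall>y\<in>C. x \<noteq> y \<longrightarrow> {x, y} \<in> snd G)"

definition set_size :: "'v set \<Rightarrow> enat" where
  "set_size C = (if finite C then enat (card C) else \<infinity>)"

text \<open>The supremum is taken in \<^typ>\<open>enat\<close>, so a finite value is attained by some clique and
  also says that there is no infinite clique.\<close>

definition clique_number :: "'v graph \<Rightarrow> enat" where
  "clique_number G = Sup {set_size C | C. clique G C}"

text \<open>The map \<open>q\<close> is meant to be a quadratic form. Only \<open>q (- v) = q v\<close> matters for
  the edge condition to be symmetric in \<open>x\<close> and \<open>y\<close>.\<close>

definition quadratic_graph :: "('v::ab_group_add \<Rightarrow> 'a) \<Rightarrow> 'a \<Rightarrow> 'v graph" where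
  "quadratic_graph q a = (UNIV, {{x, y} | x y. x \<noteq> y \<and> q (x - y) = a})"

definition sum_of_squares :: "'a::field ^ 'n \<Rightarrow> 'a" where
  "sum_of_squares x = (\<Sum>i\<in>UNIV. (x $ i)\<^sup>2)"

end

theory Submission
  imports Defs "HOL-Analysis.Determinants"
begin

text \<open>
  Translate a clique so that it contains 0. The other members \<open>v\<^sub>1, \<dots>, v\<^sub>k\<close> then have the Gram matrix
  \<open>(I + J) / 2\<close>, with \<open>J\<close> the all-ones matrix. In characteristic 0 it is nonsingular, so \<open>k \<le> n\<close>. If
  \<open>k = n\<close>, it equals \<open>A A\<^sup>T\<close> for the square matrix \<open>A\<close> with rows \<open>v\<^sub>i\<close>, hence
  \<open>(n + 1) / 2\<^sup>n = (det A)\<^sup>2\<close>, and for even \<open>n\<close> this makes \<open>n + 1\<close> a square.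

  Conversely, the standard basis vectors are at squared distance 2 from each other, and so is the
  point \<open>t (1, \<dots>, 1)\<close> from all of them when \<open>n t\<^sup>2 - 2 t - 1 = 0\<close>, which is solvable if \<open>n + 1\<close> is a
  square. For even \<open>n\<close> the map \<open>(x, y) \<mapsto> ((x + y) / 2, (x - y) / 2)\<close>, applied to pairs of
  coordinates, halves all squared distances.
\<close>

section \<open>Scalar products, squared distances and cliques\<close>

lemma scalar_product_sum_left:
  fixes w :: "'a::comm_ring_1 ^ 'n"
  shows "scalar_product (\<Sum>x\<in>S. c x *s f x) w = (\<Sum>x\<in>S. c x * scalar_product (f x) w)"
  unfolding scalar_product_def
  by (simp add: sum_distrib_right sum_distrib_left mult.assoc)
     (rule sum.swap)

lemma sum_of_squares_eq_scalar_product: "sum_of_squares x = scalar_product x x"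
  by (simp add: sum_of_squares_def scalar_product_def power2_eq_square)

lemma sum_of_squares_diff:
  "sum_of_squares (x - y) = sum_of_squares x - 2 * scalar_product x y + sum_of_squares y"
  by (simp add: sum_of_squares_def scalar_product_def power2_diff sum.distrib sum_subtractf
      sum_distrib_left algebra_simps)

lemma sum_of_squares_minus_commute: "sum_of_squares (x - y) = sum_of_squares (y - x)"
  by (simp add: sum_of_squares_def power2_commute)

lemma clique_sum_of_squares_iff:
  "clique (quadratic_graph sum_of_squares a) C \<longleftrightarrow>
    (\<forall>x\<in>C. \<forall>y\<in>C. x \<noteq> y \<longrightarrow> sum_of_squares (x - y) = a)"
  unfolding clique_def quadratic_graph_def
  by (auto simp: doubleton_eq_iff sum_of_squares_minus_commute) (metis sum_of_squares_minus_commute)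

lemma clique_subset: "clique G C \<Longrightarrow> B \<subseteq> C \<Longrightarrow> clique G B"
  by (auto simp: clique_def)

lemma clique_number_ge:
  assumes "clique G C" "finite C"
  shows "enat (card C) \<le> clique_number G"
  unfolding clique_number_def using assms by (intro Sup_upper) (auto simp: set_size_def)

text \<open>Bounding finite cliques is enough: an infinite clique would contain finite subsets of
  every size, and these are again cliques.\<close>

lemma clique_number_le:
  assumes "\<And>C. clique G C \<Longrightarrow> finite C \<Longrightarrow> card C \<le> m"
  shows "clique_number G \<le> enat m"
  unfolding clique_number_def
proof (rule Sup_least)
  fix s assume "s \<in> {set_size C |C. clique G C}"
  then obtain C where C: "clique G C" "s = set_size C" by blast
  have "finite C"
  proof (rule ccontr)
    assume "infinite C"
    then obtain B where "finite B" "card B = Suc m" "B \<subseteq> C"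
      using infinite_arbitrarily_large by blast
    with assms[of B] clique_subset[OF C(1)] show False by simp
  qed
  then show "s \<le> enat m"
    using assms C by (simp add: set_size_def)
qed


section \<open>The upper bound\<close>

text \<open>Pairing a linear relation with one of its vectors \<open>v\<close> gives
  \<open>(u v + s) / 2 = 0\<close>, where \<open>s\<close> is the sum of all coefficients. So every
  coefficient is \<open>- s\<close>, and summing them gives \<open>(card S + 1) * s = 0\<close>.
  Characteristic 0 then forces \<open>s = 0\<close>.\<close>

lemma independent_of_regular_simplex:
  fixes B :: "('a::field_char_0 ^ 'n) set"
  assumes gram: "\<And>x y. x \<in> B \<Longrightarrow> y \<in> B \<Longrightarrow> scalar_product x y = (if x = y then 1 else 1/2)"
  shows "vec.independent B"
  unfolding vec.independent_explicit_finite_subsets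
proof (intro allI impI ballI)
  fix S u w
  assume S: "S \<subseteq> B" "finite S" and rel: "(\<Sum>v\<in>S. u v *s v) = 0" and "w \<in> S"
  define s where "s = sum u S"
  have u: "u v = - s" if "v \<in> S" for v
  proof -
    have "0 = scalar_product (\<Sum>x\<in>S. u x *s x) v"
      by (simp add: rel scalar_product_def)
    also have "\<dots> = (\<Sum>x\<in>S. u x * (if x = v then 1 else 1/2))"
      unfolding scalar_product_sum_left
      using S that by (intro sum.cong refl) (simp add: gram subset_iff)
    also have "\<dots> = (\<Sum>x\<in>S. (if x = v then u x / 2 else 0) + u x / 2)"
      by (intro sum.cong refl) auto
    also have "\<dots> = (u v + s) / 2"
      using S that by (simp add: sum.distrib s_def sum_divide_distrib add_divide_distrib)
    finally show ?thesis by (simp add: eq_neg_iff_add_eq_0)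
  qed
  have "s = (\<Sum>v\<in>S. - s)"
    by (subst s_def) (intro sum.cong refl u)
  moreover have "of_nat (card S + 1) * s = s - (\<Sum>v\<in>S. - s)"
    by (simp add: distrib_right)
  ultimately have "of_nat (card S + 1) * s = 0"
    by (simp only: right_minus_eq)
  then have "s = 0"
    using of_nat_eq_0_iff[of "card S + 1", where 'a='a] by (simp del: of_nat_add)
  with u \<open>w \<in> S\<close> show "u w = 0" by simp
qed

section \<open>The determinant of \<open>I + J\<close> and the square condition\<close>

lemma det_identity_replace_column:
  fixes w :: "'a::field ^ 'n"
  shows "det (\<chi> i j. if j = k then w $ i else if i = j then 1 else 0) = w $ k"
  using cramer_lemma[of k "mat 1" w] unfolding matrix_vector_mul_lid det_I
  by (simp add: mat_def cong: if_cong)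

lemma det_identity_replace_row:
  fixes w :: "'a::field ^ 'n"
  shows "det (\<chi> i j. if i = k then w $ j else if i = j then 1 else 0) = w $ k"
proof -
  have "(\<chi> i j. if i = k then w $ j else if i = j then 1 else 0) =
      Finite_Cartesian_Product.transpose (\<chi> i j. if j = k then w $ i else if i = j then 1 else 0)"
    by (auto simp: Finite_Cartesian_Product.transpose_def vec_eq_iff)
  then show ?thesis by (simp add: det_identity_replace_column)
qed

text \<open>Each column of \<open>I + J\<close> sums to n + 1. Left multiplication by
  \<open>R\<close> replaces row \<open>k\<close> by the sum of all rows, which yields
  \<open>R ** M = Q ** R\<close>. Here \<open>R\<close> and \<open>Q\<close> differ from the
  identity in one row or one column only, so their determinants are the diagonal entries 1 and n +
  1.\<close>

lemma det_identity_plus_ones: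
  "det (\<chi> i j. if i = j then 2 else 1 :: 'a::field ^ 'n ^ 'n) = of_nat (CARD('n) + 1)"
proof -
  define M :: "'a ^ 'n ^ 'n" where "M = (\<chi> i j. if i = j then 2 else 1)"
  fix k :: 'n
  define w :: "'a ^ 'n" where "w = (\<chi> i. if i = k then of_nat (CARD('n) + 1) else 1)"
  define R :: "'a ^ 'n ^ 'n"
    where "R = (\<chi> i j. if i = k then (1 :: 'a ^ 'n) $ j else if i = j then 1 else 0)"
  define Q :: "'a ^ 'n ^ 'n"
    where "Q = (\<chi> i j. if j = k then w $ i else if i = j then 1 else 0)"
  have M_split: "M $ i $ j = 1 + (if i = j then 1 else 0)" for i j
    by (simp add: M_def)
  have mult: "(A ** B) $ i $ j = (\<Sum>l\<in>UNIV. A $ i $ l * B $ l $ j)"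
    for A B :: "'a ^ 'n ^ 'n" and i j
    by (simp add: matrix_matrix_mult_def)
  have "(R ** M) $ i $ j = (Q ** R) $ i $ j" for i j
  proof (cases "i = k")
    case True
    have "(R ** M) $ i $ j = of_nat (CARD('n) + 1)"
      using True by (simp add: mult R_def M_split sum.distrib)
    moreover have "(Q ** R) $ i $ j = (\<Sum>l\<in>UNIV. if l = k then of_nat (CARD('n) + 1) else 0)"
      unfolding mult using True by (intro sum.cong refl) (auto simp: R_def Q_def w_def)
    ultimately show ?thesis by simp
  next
    case False
    have "(R ** M) $ i $ j = (\<Sum>l\<in>UNIV. if l = i then M $ l $ j else 0)"
      unfolding mult using False by (intro sum.cong refl) (auto simp: R_def)
    moreover have "(Q ** R) $ i $ j =
        (\<Sum>l\<in>UNIV. (if l = k then 1 else 0) + (if l = i then (if i = j then 1 else 0) else 0))"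
      unfolding mult using False by (intro sum.cong refl) (auto simp: R_def Q_def w_def)
    ultimately show ?thesis by (simp add: sum.distrib M_split)
  qed
  then have "det R * det M = det Q * det R"
    by (metis det_mul vec_eq_iff)
  moreover have "det R = 1" "det Q = of_nat (CARD('n) + 1)"
    unfolding R_def Q_def det_identity_replace_row det_identity_replace_column
    by (simp_all add: w_def)
  ultimately show ?thesis by (simp add: M_def)
qed

lemma square_if_regular_simplex:
  fixes v :: "'n \<Rightarrow> 'a::field_char_0 ^ 'n"
  assumes gram: "\<And>i j. scalar_product (v i) (v j) = (if i = j then 1 else 1/2)"
    and "even CARD('n)"
  shows "\<exists>y::'a. y\<^sup>2 = of_nat (CARD('n) + 1)"
proof -
  define A where "A = (\<chi> i. v i)"
  \<comment> \<open>The factor 2 is applied row by row, so that the determinant releases one factor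
    2 per row.\<close>
  have "(\<chi> i j. if i = j then 2 else 1) = (\<chi> i. 2 *s (A ** Finite_Cartesian_Product.transpose A) $ i)"
    by (simp add: vec_eq_iff A_def matrix_matrix_mult_def Finite_Cartesian_Product.transpose_def
        gram[unfolded scalar_product_def])
  then have "of_nat (CARD('n) + 1) = 2 ^ CARD('n) * (det A)\<^sup>2"
    using det_identity_plus_ones[where 'a='a and 'n='n]
    by (simp add: det_rows_mul det_mul power2_eq_square del: of_nat_add)
  also have "\<dots> = (2 ^ (CARD('n) div 2) * det A)\<^sup>2"
    using \<open>even CARD('n)\<close> by (simp add: power_mult_distrib flip: power_mult)
  finally show ?thesis by metis
qed

lemma clique_card_bounds:
  fixes C :: "('a::field_char_0 ^ 'n) set"
  assumes clique: "clique (quadratic_graph sum_of_squares 1) C" and "finite C"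
  shows "card C \<le> CARD('n) + 1"
    and "even CARD('n) \<Longrightarrow> card C = CARD('n) + 1 \<Longrightarrow> \<exists>y::'a. y\<^sup>2 = of_nat (CARD('n) + 1)"
proof -
  \<comment> \<open>The clique is moved so that \<open>c\<close> becomes 0, which is then dropped.
    Expanding \<open>sum_of_squares (x - y) = 1\<close> for two distinct remaining points leaves 1/2
    as their scalar product.\<close>
  define B where "B c = (\<lambda>x. x - c) ` (C - {c})" for c
  have card_B: "card (B c) = card C - 1" if "c \<in> C" for c
    unfolding B_def using that \<open>finite C\<close>
    by (subst card_image) (auto simp: inj_on_def)
  have gram: "scalar_product x y = (if x = y then 1 else 1/2)"
    if c: "c \<in> C" and "x \<in> B c" "y \<in> B c" for c x y
  proof -
    from that obtain x' y' where xy: "x' \<in> C" "y' \<in> C" "x' \<noteq> c" "y' \<noteq> c" "x = x' - c" "y = y' - c"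
      by (auto simp: B_def)
    with clique c have q: "sum_of_squares x = 1" "sum_of_squares y = 1"
      by (auto simp: clique_sum_of_squares_iff)
    show ?thesis
    proof (cases "x = y")
      case True
      with q show ?thesis by (simp add: sum_of_squares_eq_scalar_product)
    next
      case False
      with clique xy have "sum_of_squares (x - y) = 1"
        by (auto simp: clique_sum_of_squares_iff)
      with False show ?thesis
        by (simp add: sum_of_squares_diff q field_simps)
    qed
  qed
  show "card C \<le> CARD('n) + 1"
  proof (cases "C = {}")
    case False
    then obtain c where c: "c \<in> C" by blast
    have "vec.independent (B c)"
      by (rule independent_of_regular_simplex) (rule gram[OF c])
    then have "card (B c) \<le> CARD('n)"
      using vec.independent_bound_general dim_subset_UNIV_cart_gen order_trans by blast
    with card_B[OF c] show ?thesis by simp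
  qed simp
  show "\<exists>y::'a. y\<^sup>2 = of_nat (CARD('n) + 1)" if "even CARD('n)" "card C = CARD('n) + 1"
  proof -
    from that(2) obtain c where c: "c \<in> C" by fastforce
    have "finite (B c)" "card (B c) = CARD('n)"
      using that(2) card_B[OF c] \<open>finite C\<close> by (simp_all add: B_def)
    then obtain v :: "'n \<Rightarrow> 'a ^ 'n" where v: "bij_betw v UNIV (B c)"
      using finite_same_card_bij[of "UNIV :: 'n set" "B c"] by auto
    have "scalar_product (v i) (v j) = (if i = j then 1 else 1/2)" for i j
      using gram[OF c bij_betwE[OF v, rule_format, of i] bij_betwE[OF v, rule_format, of j]]
        inj_eq[OF bij_betw_imp_inj_on[OF v], of i j] by simp
    with that(1) show ?thesis by (rule square_if_regular_simplex[rotated])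
  qed
qed


section \<open>The lower bound\<close>

text \<open>The identity ((a + b) / 2)^2 + ((a - b) / 2)^2 = (a^2 + b^2) / 2 is applied to paired
  coordinates. Rescaling by a scalar would require 1/2 to be a square in the field.\<close>

lemma exists_halving_similarity:
  assumes "even CARD('n::finite)"
  obtains T :: "'a::field_char_0 ^ 'n \<Rightarrow> 'a ^ 'n"
    where "\<And>x y. T (x - y) = T x - T y" "\<And>x. sum_of_squares (T x) = sum_of_squares x / 2"
proof -
  obtain S :: "'n set" where S: "card S = CARD('n) div 2"
    using obtain_subset_with_card_n[of "CARD('n) div 2" "UNIV :: 'n set"] by auto
  have "card (- S) = card S"
    using S assms by (simp add: Compl_eq_Diff_UNIV card_Diff_subset) presburger
  then obtain g where g: "bij_betw g S (- S)"
    using finite_same_card_bij[of S "- S"] by auto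
  \<comment> \<open>Coordinate \<open>i\<close> in \<open>S\<close> is paired with
    \<open>g i\<close> outside; \<open>h\<close> leads back from there to the partner in
    \<open>S\<close>.\<close>
  define h where "h = inv_into S g"
  have hg: "h (g i) = i" if "i \<in> S" for i
    using g that by (simp add: h_def bij_betw_inv_into_left)
  have gS: "g i \<notin> S" if "i \<in> S" for i
    using g that by (auto simp: bij_betw_def)
  have split: "sum_of_squares x = (\<Sum>i\<in>S. (x $ i)\<^sup>2 + (x $ g i)\<^sup>2)" for x :: "'a ^ 'n"
  proof -
    have "sum_of_squares x = (\<Sum>i\<in>S. (x $ i)\<^sup>2) + (\<Sum>i\<in>- S. (x $ i)\<^sup>2)"
      unfolding sum_of_squares_def
      by (subst sum.union_disjoint[symmetric]) auto
    then show ?thesis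
      by (simp add: sum.distrib sum.reindex_bij_betw[OF g, of "\<lambda>i. (x $ i)\<^sup>2"])
  qed
  define T :: "'a ^ 'n \<Rightarrow> 'a ^ 'n" where
    "T x = (\<chi> i. if i \<in> S then (x $ i + x $ g i) / 2 else (x $ h i - x $ i) / 2)" for x
  show thesis
  proof
    show "T (x - y) = T x - T y" for x y
      by (simp add: T_def vec_eq_iff field_simps)
    show "sum_of_squares (T x) = sum_of_squares x / 2" for x
      unfolding split sum_divide_distrib
      by (intro sum.cong refl) (simp add: T_def hg gS field_simps power2_eq_square)
  qed
qed

lemma clique_number_ge_card_distance_two:
  fixes P :: "('a::field_char_0 ^ 'n) set"
  assumes "even CARD('n)" "finite P"
    and dist: "\<And>x y. x \<in> P \<Longrightarrow> y \<in> P \<Longrightarrow> x \<noteq> y \<Longrightarrow> sum_of_squares (x - y) = 2"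
  shows "enat (card P) \<le> clique_number (quadratic_graph (sum_of_squares :: 'a ^ 'n \<Rightarrow> 'a) 1)"
proof -
  obtain T :: "'a ^ 'n \<Rightarrow> 'a ^ 'n" where
    T: "\<And>x y. T (x - y) = T x - T y" "\<And>x. sum_of_squares (T x) = sum_of_squares x / 2"
    using exists_halving_similarity[OF assms(1), where 'a='a] by blast
  have T_dist: "sum_of_squares (T x - T y) = 1" if "x \<in> P" "y \<in> P" "x \<noteq> y" for x y
    using dist[OF that] T(2)[of "x - y"] by (simp add: T(1))
  \<comment> \<open>Distinct points of \<open>P\<close> have images at squared distance 1, whereas
    equal images would be at squared distance 0.\<close>
  have "inj_on T P"
    by (rule inj_onI, rule ccontr) (use T_dist in \<open>force simp: sum_of_squares_def\<close>)
  moreover have "clique (quadratic_graph sum_of_squares 1) (T ` P)"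
    unfolding clique_sum_of_squares_iff using T_dist by auto
  ultimately show ?thesis
    using clique_number_ge[of _ "T ` P"] \<open>finite P\<close> by (simp add: card_image)
qed

section \<open>Points at mutual squared distance 2\<close>

lemma sum_of_squares_axis_diff:
  assumes "i \<noteq> j"
  shows "sum_of_squares (axis i 1 - axis j 1 :: 'a::field ^ 'n) = 2"
proof -
  have "sum_of_squares (axis i 1 - axis j 1 :: 'a ^ 'n) =
      (\<Sum>k\<in>UNIV. (if k = i then 1 else 0) + (if k = j then 1 else 0))"
    unfolding sum_of_squares_def using assms by (intro sum.cong refl) (auto simp: axis_def)
  then show ?thesis by (simp add: sum.distrib)
qed

lemma sum_of_squares_diag_diff_axis:
  fixes t :: "'a::field"
  shows "sum_of_squares (vec t - axis i 1 :: 'a ^ 'n) = of_nat CARD('n) * t\<^sup>2 - 2 * t + 1"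
proof -
  have "sum_of_squares (vec t - axis i 1 :: 'a ^ 'n) =
      (\<Sum>k\<in>UNIV. t\<^sup>2 + (if k = i then 1 - 2 * t else 0))"
    unfolding sum_of_squares_def
    by (intro sum.cong refl) (auto simp: axis_def power2_eq_square algebra_simps)
  then show ?thesis by (simp add: sum.distrib)
qed

lemma card_range_axis: "card (range (\<lambda>i. axis i 1 :: 'a::zero_neq_one ^ 'n)) = CARD('n)"
  by (intro card_image injI) (simp add: axis_eq_axis)

lemma clique_number_ge_card:
  assumes "even CARD('n::finite)"
  shows "enat CARD('n) \<le>
    clique_number (quadratic_graph (sum_of_squares :: 'a::field_char_0 ^ 'n \<Rightarrow> 'a) 1)"
proof -
  let ?P = "range (\<lambda>i. axis i 1 :: 'a ^ 'n)"
  have "enat (card ?P) \<le> clique_number (quadratic_graph (sum_of_squares :: 'a ^ 'n \<Rightarrow> 'a) 1)"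
    by (rule clique_number_ge_card_distance_two)
      (use assms in \<open>auto simp: axis_eq_axis intro: sum_of_squares_axis_diff\<close>)
  then show ?thesis by (simp add: card_range_axis)
qed

lemma clique_number_ge_card_plus_one:
  fixes y :: "'a::field_char_0"
  assumes "even CARD('n::finite)" and y: "y\<^sup>2 = of_nat (CARD('n) + 1)"
  shows "enat (CARD('n) + 1) \<le>
    clique_number (quadratic_graph (sum_of_squares :: 'a ^ 'n \<Rightarrow> 'a) 1)"
proof -
  define N where "N = (of_nat CARD('n) :: 'a)"
  \<comment> \<open>A root of \<open>N * t\<^sup>2 - 2 * t - 1\<close>, whose discriminant
    \<open>4 * (N + 1)\<close> is the square of \<open>2 * y\<close>.\<close>
  define t where "t = (1 + y) / N"
  have N: "N \<noteq> 0" by (simp add: N_def)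
  have "N * t\<^sup>2 - 2 * t - 1 = (y\<^sup>2 - 1 - N) / N"
    using N by (simp add: t_def field_simps power2_eq_square)
  also have "\<dots> = 0"
    by (simp add: y N_def)
  finally have "N * t\<^sup>2 - 2 * t + 1 = 2" by (simp add: algebra_simps)
  then have d: "sum_of_squares (vec t - axis i 1 :: 'a ^ 'n) = 2" for i
    by (simp add: sum_of_squares_diag_diff_axis N_def)
  \<comment> \<open>Coincidence with a basis vector would turn the squared distance 2 into 0, which
    is impossible in characteristic 0.\<close>
  have new: "vec t \<notin> range (\<lambda>i. axis i 1 :: 'a ^ 'n)"
  proof
    assume "vec t \<in> range (\<lambda>i. axis i 1 :: 'a ^ 'n)"
    then obtain i where "vec t = (axis i 1 :: 'a ^ 'n)" by blast
    with d[of i] show False by (simp add: sum_of_squares_def)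
  qed
  let ?P = "insert (vec t) (range (\<lambda>i. axis i 1 :: 'a ^ 'n))"
  have "enat (card ?P) \<le> clique_number (quadratic_graph (sum_of_squares :: 'a ^ 'n \<Rightarrow> 'a) 1)"
  proof (rule clique_number_ge_card_distance_two)
    show "sum_of_squares (x - z) = 2" if "x \<in> ?P" "z \<in> ?P" "x \<noteq> z" for x z
      using that d sum_of_squares_minus_commute[of "axis _ 1" "vec t :: 'a ^ 'n"]
      by (auto simp: axis_eq_axis sum_of_squares_axis_diff)
  qed (use assms in auto)
  then show ?thesis by (simp add: card_range_axis new)
qed

theorem theorem5p4:
  fixes n :: nat
  assumes "CARD('n::finite) = n" and "n > 0" and "even n"
  shows "clique_number (quadratic_graph (sum_of_squares :: 'a::field_char_0 ^ 'n \<Rightarrow> 'a) 1) =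
    (if \<not> (\<exists>y::'a. y\<^sup>2 = of_nat (n + 1)) then enat n else enat (n + 1))"
proof (cases "\<exists>y::'a. y\<^sup>2 = of_nat (n + 1)")
  case True
  then obtain y :: 'a where "y\<^sup>2 = of_nat (n + 1)" by blast
  then have "enat (n + 1) \<le>
      clique_number (quadratic_graph (sum_of_squares :: 'a ^ 'n \<Rightarrow> 'a) 1)"
    using clique_number_ge_card_plus_one[where 'n='n, of y] assms by simp
  moreover have "clique_number (quadratic_graph (sum_of_squares :: 'a ^ 'n \<Rightarrow> 'a) 1) \<le> enat (n + 1)"
    using clique_card_bounds(1)[where 'a='a and 'n='n] assms(1) by (intro clique_number_le) simp
  ultimately show ?thesis using True by (simp del: of_nat_add)
next
  case False
  have "clique_number (quadratic_graph (sum_of_squares :: 'a ^ 'n \<Rightarrow> 'a) 1) \<le> enat n"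
  proof (rule clique_number_le)
    fix C :: "('a ^ 'n) set"
    assume "clique (quadratic_graph sum_of_squares 1) C" "finite C"
    with clique_card_bounds[of C] False assms have "card C \<le> n + 1" "card C \<noteq> n + 1"
      by blast+
    then show "card C \<le> n" by simp
  qed
  moreover have "enat n \<le> clique_number (quadratic_graph (sum_of_squares :: 'a ^ 'n \<Rightarrow> 'a) 1)"
    using clique_number_ge_card[where 'a='a and 'n='n] assms by simp
  ultimately show ?thesis using False by (simp del: of_nat_add)
qed

end
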